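(* Let $p$ be an odd prime and let $P,Q$ be rational numbers with denominators not divisible by $p$, such that $p\nmid PQ$. Then $$\sum_{k=0}^{[p/4]}\binom{4k}{2k}\Big(\frac{P^2}{64Q}\Big)^k\equiv(-Q)^{-[p/4]}\,U_{\frac{p+(\frac{-1}p)}2}(P,Q)\pmod p$$ and $$\sum_{k=0}^{[p/4]}\binom{4k}{2k}\Big(\frac Q{4P^2}\Big)^k\equiv\Big(\frac Pp\Big)U_{\frac{p+1}2}(P,Q)\pmod p.$$
   Context: $[x]$ is the greatest integer not exceeding $x$. The Lucas sequence $U_n(P,Q)$ is defined by $U_0=0$, $U_1=1$, $U_{n+1}=PU_n-QU_{n-1}$ for $n\ge1$. For a rational $r$ with denominator prime to $p$, $\big(\frac rp\big)$ is the Legendre symbol of its residue mod $p$; congruences mod $p$ are taken in the ring of rationals with denominator prime to $p$ ("$p\nmid PQ$" means $PQ\not\equiv0\pmod p$). *)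

theory Defs
  imports "HOL-Number_Theory.Number_Theory"
begin

fun lucas_U :: "rat \<Rightarrow> rat \<Rightarrow> nat \<Rightarrow> rat" where
  "lucas_U P Q 0 = 0"
| "lucas_U P Q (Suc 0) = 1"
| "lucas_U P Q (Suc (Suc n)) = P * lucas_U P Q (Suc n) - Q * lucas_U P Q n"

text \<open>\<^const>\<open>quotient_of\<close> yields numerator and (positive) denominator in lowest terms.\<close>

definition p_integral :: "nat \<Rightarrow> rat \<Rightarrow> bool" where
  "p_integral p r \<longleftrightarrow> \<not> int p dvd snd (quotient_of r)"

text \<open>The witness \<open>c\<close> must itself be \<open>p\<close>-integral: in the field of rationals every element is a multiple of \<open>p\<close>.\<close>

definition rat_cong :: "nat \<Rightarrow> rat \<Rightarrow> rat \<Rightarrow> bool" where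
  "rat_cong p a b \<longleftrightarrow>
     p_integral p a \<and> p_integral p b \<and> (\<exists>c. p_integral p c \<and> a - b = of_nat p * c)"

text \<open>The residue exists and is unique when \<open>p\<close> is prime and \<open>r\<close> is \<open>p\<close>-integral.\<close>

definition rat_residue :: "nat \<Rightarrow> rat \<Rightarrow> int" where
  "rat_residue p r = (THE a. 0 \<le> a \<and> a < int p \<and> rat_cong p r (of_int a))"

definition rat_Legendre :: "rat \<Rightarrow> nat \<Rightarrow> int" where
  "rat_Legendre r p = Legendre (rat_residue p r) (int p)"

end

theory Submission
  imports Defs
begin

text \<open>
  Expand \<open>U\<^sub>n\<^sub>+\<^sub>1 = \<Sum>k. C(n-k, k) P\<^bsup>n-2k\<^esup> (-Q)\<^sup>k\<close>. In both cases of the first congruence the index is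
  \<open>2m + 1\<close> with \<open>m = [p/4]\<close>; reversing the sum produces the coefficients \<open>C(m+k, 2k)\<close>. In the second
  the index is \<open>n + 1\<close> with \<open>n = (p-1)/2\<close>, and \<open>P\<^sup>n\<close> is \<open>(P/p)\<close> by Euler's criterion. Modulo \<open>p\<close>, the
  relations \<open>(4m+1)(4m+3) = 0\<close> and \<open>2n + 1 = 0\<close> make \<open>(-64)\<^sup>k C(m+k, 2k)\<close> and \<open>(-4)\<^sup>k C(n-k, k)\<close>
  satisfy the same first-order recurrence in \<open>k\<close> as \<open>C(4k, 2k)\<close>.
\<close>

section \<open>Rationals with denominator prime to \<open>p\<close>\<close>

text \<open>The denominator in lowest terms divides the denominator of every other representing
  fraction, so one fraction with denominator prime to \<open>p\<close> is enough. Closure properties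
  can then be shown without reducing fractions.\<close>

lemma p_integral_iff:
  "p_integral p r \<longleftrightarrow> (\<exists>a b. \<not> int p dvd b \<and> r = of_int a / of_int b)"
proof
  assume *: "p_integral p r"
  obtain a b where ab: "quotient_of r = (a, b)" by fastforce
  with * have "\<not> int p dvd b" by (simp add: p_integral_def)
  with quotient_of_div[OF ab] show "\<exists>a b. \<not> int p dvd b \<and> r = of_int a / of_int b" by blast
next
  assume "\<exists>a b. \<not> int p dvd b \<and> r = of_int a / of_int b"
  then obtain a b where ab: "\<not> int p dvd b" "r = of_int a / of_int b" by blast
  obtain c d where cd: "quotient_of r = (c, d)" by fastforce
  have d: "d > 0" using quotient_of_denom_pos[OF cd] .
  have b: "b \<noteq> 0" using ab(1) by auto
  have "of_int c / of_int d = (of_int a / of_int b :: rat)"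
    using quotient_of_div[OF cd] ab(2) by simp
  hence "of_int (c * b) = (of_int (a * d) :: rat)"
    using b d by (simp add: field_simps)
  hence "c * b = a * d" by (simp only: of_int_eq_iff)
  hence "d dvd c * b" by simp
  with quotient_of_coprime[OF cd] have "d dvd b"
    by (metis coprime_commute coprime_dvd_mult_right_iff)
  with ab(1) have "\<not> int p dvd d" by (meson dvd_trans)
  thus "p_integral p r" by (simp add: p_integral_def cd)
qed

context
  fixes p :: nat
  assumes p: "prime p"
begin

lemma p_integral_of_int [simp]: "p_integral p (of_int a)"
  using prime_gt_1_nat[OF p] unfolding p_integral_iff
  by (intro exI[of _ a] exI[of _ 1]) auto

lemma p_integral_of_nat [simp]: "p_integral p (of_nat n)"
  using p_integral_of_int[of "int n"] by simp

lemma p_integral_numeral [simp]: "p_integral p (numeral n)"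
  using p_integral_of_int[of "numeral n"] by simp

lemma p_integral_0 [simp]: "p_integral p 0"
  using p_integral_of_int[of 0] by simp

lemma p_integral_1 [simp]: "p_integral p 1"
  using p_integral_of_int[of 1] by simp

lemma p_integral_add:
  assumes "p_integral p a" "p_integral p b"
  shows "p_integral p (a + b)"
proof -
  from assms obtain x y u v
    where *: "\<not> int p dvd y" "a = of_int x / of_int y" "\<not> int p dvd v" "b = of_int u / of_int v"
    unfolding p_integral_iff by blast
  have "y \<noteq> 0" "v \<noteq> 0" using * by auto
  hence "a + b = of_int (x * v + u * y) / of_int (y * v)" using * by (simp add: field_simps)
  moreover have "\<not> int p dvd y * v" using * p by (simp add: prime_dvd_mult_iff)
  ultimately show ?thesis unfolding p_integral_iff by blast
qed

lemma p_integral_mult: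
  assumes "p_integral p a" "p_integral p b"
  shows "p_integral p (a * b)"
proof -
  from assms obtain x y u v
    where *: "\<not> int p dvd y" "a = of_int x / of_int y" "\<not> int p dvd v" "b = of_int u / of_int v"
    unfolding p_integral_iff by blast
  have "a * b = of_int (x * u) / of_int (y * v)" using * by simp
  moreover have "\<not> int p dvd y * v" using * p by (simp add: prime_dvd_mult_iff)
  ultimately show ?thesis unfolding p_integral_iff by blast
qed

lemma p_integral_minus: "p_integral p a \<Longrightarrow> p_integral p (- a)"
  using p_integral_mult[of "of_int (-1)" a] p_integral_of_int[of "-1"] by simp

lemma p_integral_diff: "p_integral p a \<Longrightarrow> p_integral p b \<Longrightarrow> p_integral p (a - b)"
  using p_integral_add[of a "- b"] p_integral_minus by simp

lemma p_integral_power: "p_integral p a \<Longrightarrow> p_integral p (a ^ n)"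
  by (induction n) (auto intro: p_integral_mult)

lemma p_integral_sum: "(\<And>x. x \<in> A \<Longrightarrow> p_integral p (f x)) \<Longrightarrow> p_integral p (sum f A)"
  by (induction A rule: infinite_finite_induct) (auto intro: p_integral_add)

lemmas p_integral_intros = p_integral_add p_integral_mult p_integral_minus p_integral_diff
  p_integral_power p_integral_sum

section \<open>Congruence modulo \<open>p\<close> on \<open>p\<close>-integral rationals\<close>

lemma rat_congI:
  assumes "p_integral p a" "p_integral p c" "b = a - of_nat p * c"
  shows "rat_cong p a b"
  using assms unfolding rat_cong_def by (auto intro!: p_integral_intros)

lemma rat_cong_refl: "p_integral p a \<Longrightarrow> rat_cong p a a"
  by (rule rat_congI[where c = 0]) auto

lemma rat_cong_sym:
  assumes "rat_cong p a b" shows "rat_cong p b a"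
proof -
  from assms obtain c where "p_integral p b" "p_integral p c" "a - b = of_nat p * c"
    unfolding rat_cong_def by blast
  thus ?thesis by (intro rat_congI[where c = "- c"]) (auto intro: p_integral_minus)
qed

lemma rat_cong_add:
  assumes "rat_cong p a b" "rat_cong p c d"
  shows "rat_cong p (a + c) (b + d)"
proof -
  from assms obtain e f where "p_integral p a" "p_integral p e" "a - b = of_nat p * e"
    "p_integral p c" "p_integral p f" "c - d = of_nat p * f"
    unfolding rat_cong_def by blast
  thus ?thesis
    by (intro rat_congI[where c = "e + f"] p_integral_add) (auto simp: algebra_simps)
qed

lemma rat_cong_trans:
  assumes "rat_cong p a b" "rat_cong p b c"
  shows "rat_cong p a c"
proof -
  from assms obtain e f where "p_integral p a" "p_integral p e" "a - b = of_nat p * e"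
    "p_integral p f" "b - c = of_nat p * f"
    unfolding rat_cong_def by blast
  thus ?thesis
    by (intro rat_congI[where c = "e + f"]) (auto intro: p_integral_intros simp: algebra_simps)
qed

lemma rat_cong_mult:
  assumes "rat_cong p a b" "rat_cong p c d"
  shows "rat_cong p (a * c) (b * d)"
proof -
  from assms obtain e f where *: "p_integral p a" "p_integral p b" "p_integral p e" "a - b = of_nat p * e"
    "p_integral p c" "p_integral p d" "p_integral p f" "c - d = of_nat p * f"
    unfolding rat_cong_def by blast
  have "a * c - b * d = a * (c - d) + (a - b) * d" by (simp add: algebra_simps)
  also have "\<dots> = of_nat p * (a * f + e * d)" unfolding * by (simp add: algebra_simps)
  finally show ?thesis using *
    by (intro rat_congI[where c = "a * f + e * d"]) (auto intro: p_integral_intros)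
qed

lemma rat_cong_power: "rat_cong p a b \<Longrightarrow> rat_cong p (a ^ n) (b ^ n)"
  by (induction n) (auto intro: rat_cong_mult rat_cong_refl)

lemma rat_cong_sum:
  "(\<And>x. x \<in> A \<Longrightarrow> rat_cong p (f x) (g x)) \<Longrightarrow> rat_cong p (sum f A) (sum g A)"
  by (induction A rule: infinite_finite_induct) (auto intro: rat_cong_add rat_cong_refl)

text \<open>Bridge to integer congruences. With witness \<open>u / v\<close>, clearing denominators
  gives that \<open>p\<close> divides \<open>(a - b) * v\<close>, and the prime \<open>p\<close>
  does not divide \<open>v\<close>.\<close>

lemma rat_cong_of_int_iff:
  "rat_cong p (of_int a) (of_int b) \<longleftrightarrow> [a = b] (mod int p)"
proof
  assume "rat_cong p (of_int a) (of_int b)"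
  then obtain c where c: "p_integral p c" "of_int a - of_int b = of_nat p * c"
    unfolding rat_cong_def by blast
  then obtain u v where uv: "\<not> int p dvd v" "c = of_int u / of_int v"
    unfolding p_integral_iff by blast
  have "v \<noteq> 0" using uv by auto
  with c uv have "of_int ((a - b) * v) = (of_int (int p * u) :: rat)" by (simp add: field_simps)
  hence "(a - b) * v = int p * u" by (simp only: of_int_eq_iff)
  hence "int p dvd (a - b) * v" by simp
  with uv p have "int p dvd a - b" by (simp add: prime_dvd_mult_iff)
  thus "[a = b] (mod int p)" by (simp add: cong_iff_dvd_diff)
next
  assume "[a = b] (mod int p)"
  then obtain k where "a - b = int p * k" by (auto simp: cong_iff_dvd_diff elim: dvdE)
  hence b: "b = a - int p * k" by simp
  show "rat_cong p (of_int a) (of_int b)"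
    unfolding b by (rule rat_congI[where c = "of_int k"]) auto
qed

section \<open>Inverses, residues and Euler's criterion\<close>

lemma p_integral_inverse:
  assumes "p_integral p r" "\<not> rat_cong p r 0"
  shows "p_integral p (inverse r)"
proof -
  from assms obtain a b where ab: "\<not> int p dvd b" "r = of_int a / of_int b"
    unfolding p_integral_iff by blast
  have "\<not> int p dvd a"
  proof
    assume "int p dvd a"
    then obtain c where "a = int p * c" by (elim dvdE)
    moreover have "p_integral p (of_int c / of_int b)" using ab(1) unfolding p_integral_iff by blast
    ultimately have "rat_cong p r 0"
      using assms(1) ab by (intro rat_congI[where c = "of_int c / of_int b"]) auto
    with assms(2) show False by blast
  qed
  moreover have "inverse r = of_int b / of_int a" using ab by simp
  ultimately show ?thesis unfolding p_integral_iff by blast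
qed

text \<open>Discharges the definite description in \<open>rat_residue\<close>: for
  \<open>r = a / b\<close> and \<open>x\<close> inverse to \<open>b\<close> modulo \<open>p\<close>,
  the residue is \<open>a * x mod p\<close>.\<close>

lemma rat_residue_cong:
  assumes "p_integral p r"
  shows "rat_cong p r (of_int (rat_residue p r))"
proof -
  have p0: "int p > 0" using prime_gt_0_nat[OF p] by simp
  from assms obtain a b where ab: "\<not> int p dvd b" "r = of_int a / of_int b"
    unfolding p_integral_iff by blast
  have "b \<noteq> 0" using ab(1) by auto
  have "coprime b (int p)"
    using ab(1) p
    by (metis coprime_commute prime_imp_coprime prime_int_nat_transfer nat_int of_nat_0_le_iff)
  then obtain x where x: "[b * x = 1] (mod int p)" using cong_solve_coprime_int by blast
  have "rat_cong p (of_int (b * x)) (of_int 1)" using x by (simp only: rat_cong_of_int_iff)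
  \<comment> \<open>Multiplying \<open>b * x\<close> == 1 by \<open>r = a / b\<close> cancels
    \<open>b\<close> exactly and leaves \<open>a * x\<close> == \<open>r\<close>.\<close>
  from rat_cong_mult[OF rat_cong_refl[OF assms] this]
  have "rat_cong p (of_int (a * x)) r" using ab \<open>b \<noteq> 0\<close> by simp
  moreover have "rat_cong p (of_int (a * x)) (of_int ((a * x) mod int p))"
    unfolding rat_cong_of_int_iff by (simp add: cong_def)
  ultimately have 1: "rat_cong p r (of_int ((a * x) mod int p))"
    using rat_cong_trans rat_cong_sym by blast
  have "\<exists>!a. 0 \<le> a \<and> a < int p \<and> rat_cong p r (of_int a)"
  proof (rule ex1I[where a = "(a * x) mod int p"])
    show "0 \<le> (a * x) mod int p \<and> (a * x) mod int p < int p
        \<and> rat_cong p r (of_int ((a * x) mod int p))"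
      using 1 p0 by simp
  next
    fix c assume c: "0 \<le> c \<and> c < int p \<and> rat_cong p r (of_int c)"
    hence "rat_cong p (of_int c) (of_int ((a * x) mod int p))"
      using 1 rat_cong_trans rat_cong_sym by blast
    hence "[c = (a * x) mod int p] (mod int p)" by (simp only: rat_cong_of_int_iff)
    thus "c = (a * x) mod int p" using c p0 by (simp add: cong_def)
  qed
  from theI'[OF this] show ?thesis unfolding rat_residue_def by blast
qed

text \<open>Euler's criterion for the integer residue, carried back to \<open>r\<close> by raising
  \<open>r\<close> and its residue to the same power.\<close>

lemma rat_euler_criterion:
  assumes "odd p" "p_integral p r"
  shows "rat_cong p (r ^ ((p - 1) div 2)) (of_int (rat_Legendre r p))"
proof -
  have "p > 2" using prime_ge_2_nat[OF p] assms(1) by (cases "p = 2") auto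
  hence "[Legendre (rat_residue p r) (int p) = rat_residue p r ^ ((p - 1) div 2)] (mod int p)"
    using euler_criterion[OF p] by simp
  hence "rat_cong p (of_int (rat_residue p r) ^ ((p - 1) div 2)) (of_int (rat_Legendre r p))"
    unfolding rat_Legendre_def of_int_power[symmetric] rat_cong_of_int_iff by (simp add: cong_sym)
  with rat_cong_power[OF rat_residue_cong[OF assms(2)]] show ?thesis
    using rat_cong_trans by blast
qed

lemma rat_Legendre_square:
  assumes "p_integral p r" "\<not> rat_cong p r 0"
  shows "rat_Legendre r p * rat_Legendre r p = 1"
proof -
  have "\<not> [rat_residue p r = 0] (mod int p)"
    using rat_residue_cong[OF assms(1)] assms(2) rat_cong_trans
    unfolding rat_cong_of_int_iff[symmetric] by auto
  thus ?thesis by (simp add: rat_Legendre_def Legendre_def)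
qed

end

section \<open>Lucas sequences and binomial coefficients\<close>

text \<open>Pascal's rule turns the Lucas recurrence into a termwise identity. Letting
  \<open>k\<close> run up to \<open>n\<close> keeps the index shifts simple; the binomials with
  \<open>2 * k > n\<close> vanish.\<close>

lemma lucas_U_Suc_sum:
  "lucas_U P Q (Suc n) = (\<Sum>k\<le>n. of_nat ((n - k) choose k) * P ^ (n - 2 * k) * (- Q) ^ k)"
proof (induction n rule: less_induct)
  case (less n)
  show ?case
  proof (cases "n < 2")
    case True
    hence "n = 0 \<or> n = 1" by auto
    thus ?thesis by (elim disjE) simp_all
  next
    case False
    then obtain m where n: "n = Suc (Suc m)"
      using that[of "n - 2"] by linarith
    define f where "f n k = of_nat ((n - k) choose k) * P ^ (n - 2 * k) * (- Q) ^ k" for n k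
    have rec: "f n (Suc k) = P * f (Suc m) (Suc k) - Q * f m k" if "k \<le> m" for k
    proof -
      have pas: "(Suc m - k) choose (Suc k) = ((m - k) choose k) + ((m - k) choose Suc k)"
        using that by (simp add: Suc_diff_le)
      \<comment> \<open>Because subtraction truncates, the exponents fit only for
        \<open>2 * k < m\<close>; in the remaining cases the binomial coefficient is 0.\<close>
      have pw: "of_nat ((m - k) choose Suc k) * P ^ (m - 2 * k)
          = of_nat ((m - k) choose Suc k) * (P * P ^ (Suc m - 2 * Suc k))"
      proof (cases "2 * k < m")
        case True
        hence "m - 2 * k = Suc (Suc m - 2 * Suc k)" by simp
        thus ?thesis by (simp only: power_Suc)
      next
        case False
        hence "(m - k) choose Suc k = 0" by (intro binomial_eq_0) auto
        thus ?thesis by simp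
      qed
      have "f n (Suc k) = of_nat ((m - k) choose k) * P ^ (m - 2 * k) * (- Q) ^ Suc k
          + (of_nat ((m - k) choose Suc k) * P ^ (m - 2 * k)) * (- Q) ^ Suc k"
        using pas by (simp add: f_def n algebra_simps)
      also have "\<dots> = P * f (Suc m) (Suc k) - Q * f m k"
        unfolding pw by (simp add: f_def algebra_simps)
      finally show ?thesis .
    qed
    have last: "f n (Suc (Suc m)) = 0" by (simp add: f_def n)
    have "lucas_U P Q (Suc n) = P * (\<Sum>k\<le>Suc m. f (Suc m) k) - Q * (\<Sum>k\<le>m. f m k)"
      using less.IH[of "Suc m"] less.IH[of m] by (simp add: n f_def)
    also have "\<dots> = P * f (Suc m) 0 + (\<Sum>k\<le>m. P * f (Suc m) (Suc k) - Q * f m k)"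
      by (subst sum.atMost_Suc_shift) (simp add: sum_subtractf sum_distrib_left algebra_simps)
    also have "\<dots> = f n 0 + (\<Sum>k\<le>m. f n (Suc k))"
      using rec by (simp add: f_def n)
    also have "\<dots> = (\<Sum>k\<le>n. f n k)"
      using sum.atMost_Suc_shift[of "f n" "Suc m"] last by (simp add: n)
    finally show ?thesis by (simp add: f_def)
  qed
qed

lemma lucas_U_Suc_sum_half:
  "lucas_U P Q (Suc n) =
     (\<Sum>k = 0..n div 2. of_nat ((n - k) choose k) * P ^ (n - 2 * k) * (- Q) ^ k)"
  unfolding lucas_U_Suc_sum by (rule sum.mono_neutral_right) auto

text \<open>Reversing the sum (\<open>k\<close> to \<open>m - k\<close>) and using symmetry of
  binomials yields increasing powers of \<open>P\<^sup>2\<close>, as in the first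
  congruence.\<close>

lemma lucas_U_odd_sum:
  "lucas_U P Q (Suc (2 * m)) =
     (\<Sum>k = 0..m. of_nat ((m + k) choose (2 * k)) * P ^ (2 * k) * (- Q) ^ (m - k))"
proof -
  have "lucas_U P Q (Suc (2 * m)) =
     (\<Sum>k = 0..m. of_nat ((2 * m - k) choose k) * P ^ (2 * m - 2 * k) * (- Q) ^ k)"
    by (simp add: lucas_U_Suc_sum_half)
  also have "\<dots> = (\<Sum>k = 0..m. of_nat ((m + k) choose (2 * k)) * P ^ (2 * k) * (- Q) ^ (m - k))"
  proof (rule sum.reindex_bij_witness[of _ "\<lambda>k. m - k" "\<lambda>k. m - k"])
    fix k assume "k \<in> {0..m}"
    hence k: "k \<le> m" by simp
    have "(2 * m - k) choose k = (2 * m - k) choose (2 * (m - k))"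
      using k by (subst binomial_symmetric) (auto simp: algebra_simps)
    thus "of_nat ((m + (m - k)) choose (2 * (m - k))) * P ^ (2 * (m - k)) * (- Q) ^ (m - (m - k))
      = of_nat ((2 * m - k) choose k) * P ^ (2 * m - 2 * k) * (- Q) ^ k"
      using k by (simp add: diff_mult_distrib2 mult_2)
  qed auto
  finally show ?thesis .
qed

section \<open>Exact first-order recurrences for the three binomial families\<close>

lemma of_nat_add_choose:
  "(of_nat ((a + b) choose a) :: rat) = fact (a + b) / (fact a * fact b)"
  by (subst binomial_fact) auto

text \<open>The quotient of consecutive terms is 2(4k+1)(4k+3) / ((k+1)(2k+1)). It is computed with
  factorials over the rationals and stated with denominators cleared.\<close>

lemma central_binomial_step:
  "((4 * Suc k) choose (2 * Suc k)) * (Suc k * (2 * k + 1))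
     = ((4 * k) choose (2 * k)) * (2 * (4 * k + 1) * (4 * k + 3))"
proof -
  \<comment> \<open>Upper arguments are displayed as sums so that \<open>of_nat_add_choose\<close>
    applies.\<close>
  have e: "4 * k = 2 * k + 2 * k" "4 * Suc k = Suc (Suc (2 * k)) + Suc (Suc (2 * k))"
    "2 * Suc k = Suc (Suc (2 * k))" by auto
  have f: "(fact (Suc (Suc (2 * k)) + Suc (Suc (2 * k))) :: rat)
      = (4 * of_nat k + 4) * ((4 * of_nat k + 3) * ((4 * of_nat k + 2) * ((4 * of_nat k + 1)
        * fact (2 * k + 2 * k))))"
    by (simp add: algebra_simps)
  have g: "(fact (Suc (Suc (2 * k))) :: rat)
      = (2 * of_nat k + 2) * ((2 * of_nat k + 1) * fact (2 * k))"
    by (simp add: algebra_simps)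
  have nz: "(2 * of_nat k + 2 :: rat) \<noteq> 0" "(2 * of_nat k + 1 :: rat) \<noteq> 0"
    by (simp_all add: add_nonneg_eq_0_iff)
  have "(of_nat (((4 * Suc k) choose (2 * Suc k)) * (Suc k * (2 * k + 1))) :: rat)
     = of_nat (((4 * k) choose (2 * k)) * (2 * (4 * k + 1) * (4 * k + 3)))"
    unfolding of_nat_mult e of_nat_add_choose f g using nz
    by (simp add: divide_simps) (simp add: algebra_simps)
  thus ?thesis by (simp only: of_nat_eq_iff)
qed

lemma binomial_add_double_step:
  assumes "k < m"
  shows "((m + Suc k) choose (2 * Suc k)) * ((2 * k + 1) * (2 * k + 2))
     = ((m + k) choose (2 * k)) * ((m + k + 1) * (m - k))"
proof -
  \<comment> \<open>Writing \<open>m\<close> as a sum removes the truncated subtraction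
    \<open>m - k\<close>, which becomes \<open>Suc d\<close>.\<close>
  obtain d where m: "m = k + 1 + d" using assms by (metis Suc_eq_plus1 add_Suc less_imp_Suc_add)
  have e: "m + Suc k = Suc (Suc (2 * k)) + d" "2 * Suc k = Suc (Suc (2 * k))"
    "m + k = 2 * k + Suc d" "m - k = Suc d" by (auto simp: m)
  have f: "(fact (Suc (Suc (2 * k)) + d) :: rat) = (2 * of_nat k + of_nat d + 2) * fact (2 * k + Suc d)"
    by (simp add: algebra_simps)
  have g: "(fact (Suc (Suc (2 * k))) :: rat)
      = (2 * of_nat k + 2) * ((2 * of_nat k + 1) * fact (2 * k))"
    by (simp add: algebra_simps)
  have h: "(fact (Suc d) :: rat) = (of_nat d + 1) * fact d" by (simp add: algebra_simps)
  have nz: "(2 * of_nat k + 2 :: rat) \<noteq> 0" "(2 * of_nat k + 1 :: rat) \<noteq> 0" "(of_nat d + 1 :: rat) \<noteq> 0"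
    by (simp_all add: add_nonneg_eq_0_iff)
  have "(of_nat (((m + Suc k) choose (2 * Suc k)) * ((2 * k + 1) * (2 * k + 2))) :: rat)
     = of_nat (((m + k) choose (2 * k)) * ((m + k + 1) * (m - k)))"
    unfolding of_nat_mult e of_nat_add_choose f g h using nz
    by (simp add: divide_simps) (simp add: algebra_simps)
  thus ?thesis by (simp only: of_nat_eq_iff)
qed

lemma binomial_diff_step:
  assumes "2 * Suc k \<le> n"
  shows "((n - Suc k) choose Suc k) * (Suc k * (n - k))
     = ((n - k) choose k) * ((n - 2 * k) * (n - 2 * k - 1))"
proof -
  obtain d where n: "n = 2 * Suc k + d" using assms by (metis le_Suc_ex)
  have e: "n - Suc k = Suc k + d" "n - k = k + Suc (Suc d)" "n - 2 * k = Suc (Suc d)"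
    "Suc (Suc d) - 1 = Suc d" by (auto simp: n)
  have f: "(fact (k + Suc (Suc d)) :: rat) = (of_nat k + of_nat d + 2) * fact (Suc k + d)"
    by (simp add: algebra_simps)
  have g: "(fact (Suc k) :: rat) = (of_nat k + 1) * fact k" by (simp add: algebra_simps)
  have h: "(fact (Suc (Suc d)) :: rat) = (of_nat d + 2) * ((of_nat d + 1) * fact d)"
    by (simp add: algebra_simps)
  have nz: "(of_nat k + 1 :: rat) \<noteq> 0" "(of_nat d + 1 :: rat) \<noteq> 0" "(of_nat d + 2 :: rat) \<noteq> 0"
    by (simp_all add: add_nonneg_eq_0_iff)
  have "(of_nat (((n - Suc k) choose Suc k) * (Suc k * (n - k))) :: rat)
     = of_nat (((n - k) choose k) * ((n - 2 * k) * (n - 2 * k - 1)))"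
    unfolding of_nat_mult e of_nat_add_choose f g h using nz
    by (simp add: divide_simps) (simp add: algebra_simps)
  thus ?thesis by (simp only: of_nat_eq_iff)
qed

section \<open>Binomial congruences modulo \<open>p\<close>\<close>

lemma coprime_int_primeI:
  assumes "prime p" "0 < j" "j < p"
  shows "coprime (int j) (int p)"
  using assms by (metis coprime_commute coprime_int_iff nat_dvd_not_less prime_imp_coprime_nat)

text \<open>Induction comparing the two recurrences. The factors (4k+1)(4k+3) and -16(m+k+1)(m-k)
  differ by (4m+1)(4m+3), where m = [p/4], and one factor of that product is \<open>p\<close>
  itself.\<close>

lemma binomial_add_double_cong:
  assumes p: "prime p" "odd p" and k: "k \<le> p div 4"
  shows "[int ((4 * k) choose (2 * k)) = int ((p div 4 + k) choose (2 * k)) * (- 64) ^ k] (mod int p)"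
  using k
proof (induction k)
  case 0
  thus ?case by simp
next
  case (Suc k)
  define m where "m = p div 4"
  define B where "B k = int ((4 * k) choose (2 * k))" for k
  define F where "F k = int ((m + k) choose (2 * k)) * (- 64) ^ k" for k
  have km: "k < m" using Suc.prems by (simp add: m_def)
  have diff: "int (m - k) = int m - int k" using km by linarith
  have IH: "[B k = F k] (mod int p)" using Suc by (simp add: B_def F_def m_def)
  have "p = 4 * m + 1 \<or> p = 4 * m + 3" using p(2) unfolding m_def by presburger
  hence "int p = 4 * int m + 1 \<or> int p = 4 * int m + 3" by presburger
  hence "int p dvd (4 * int m + 1) * (4 * int m + 3)" by (metis dvd_triv_left dvd_triv_right)
  moreover have "(4 * int k + 1) * (4 * int k + 3) - (- 16 * ((int m + int k + 1) * (int m - int k)))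
      = (4 * int m + 1) * (4 * int m + 3)" by (simp add: algebra_simps)
  ultimately have key: "[(4 * int k + 1) * (4 * int k + 3)
      = - 16 * ((int m + int k + 1) * (int m - int k))] (mod int p)"
    by (simp add: cong_iff_dvd_diff)
  have "int (((4 * Suc k) choose (2 * Suc k)) * (Suc k * (2 * k + 1)))
     = int (((4 * k) choose (2 * k)) * (2 * (4 * k + 1) * (4 * k + 3)))"
    by (simp only: central_binomial_step)
  \<comment> \<open>The central recurrence is doubled so that both recurrences carry the multiplier
    (2k+1)(2k+2); hence 4 * (-16) = -64.\<close>
  hence "B (Suc k) * (int (2 * k + 1) * int (2 * k + 2))
      = B k * (4 * ((4 * int k + 1) * (4 * int k + 3)))"
    unfolding B_def of_nat_mult by (simp add: algebra_simps)
  also have "[\<dots> = F k * (4 * (- 16 * ((int m + int k + 1) * (int m - int k))))] (mod int p)"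
    by (intro cong_mult IH key cong_refl)
  also have "F k * (4 * (- 16 * ((int m + int k + 1) * (int m - int k))))
      = int (((m + k) choose (2 * k)) * ((m + k + 1) * (m - k))) * (- 64) ^ Suc k"
    unfolding of_nat_mult diff by (simp add: F_def algebra_simps)
  also have "\<dots> = F (Suc k) * (int (2 * k + 1) * int (2 * k + 2))"
    unfolding binomial_add_double_step[OF km, symmetric] F_def of_nat_mult by (simp only: mult_ac)
  finally have "[B (Suc k) * (int (2 * k + 1) * int (2 * k + 2))
      = F (Suc k) * (int (2 * k + 1) * int (2 * k + 2))] (mod int p)" .
  \<comment> \<open>Both factors of the multiplier lie strictly between 0 and \<open>p\<close>, so
    it can be cancelled modulo \<open>p\<close>.\<close>
  moreover have "2 * k + 2 < p" using km p(2) unfolding m_def by presburger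
  hence "coprime (int (2 * k + 1) * int (2 * k + 2)) (int p)"
    by (intro coprime_mult_left_iff[THEN iffD2] conjI coprime_int_primeI[OF p(1)]) auto
  ultimately have "[B (Suc k) = F (Suc k)] (mod int p)" using cong_mult_rcancel by blast
  thus ?case by (simp only: B_def F_def m_def)
qed

text \<open>Same scheme, with 2n + 1 = p. It gives (4k+1)(4k+3) == 4(n-2k)(n-2k-1) for the
  numerators and 2k+1 == -2(n-k) for the denominators; the quotient of the constants is 2 * 4 / (-2)
  = -4.\<close>

lemma binomial_diff_cong:
  assumes p: "prime p" "odd p" and k: "k \<le> p div 4"
  shows "[int ((4 * k) choose (2 * k)) = int (((p - 1) div 2 - k) choose k) * (- 4) ^ k] (mod int p)"
  using k
proof (induction k)
  case 0
  thus ?case by simp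
next
  case (Suc k)
  define n where "n = (p - 1) div 2"
  define B where "B k = int ((4 * k) choose (2 * k))" for k
  define G where "G k = int ((n - k) choose k) * (- 4) ^ k" for k
  have kn: "2 * Suc k \<le> n" using Suc.prems p(2) unfolding n_def by presburger
  have IH: "[B k = G k] (mod int p)" using Suc by (simp add: B_def G_def n_def)
  have diffs: "int (n - 2 * k - 1) = int n - 2 * int k - 1" "int (n - 2 * k) = int n - 2 * int k"
    using kn by (simp_all add: of_nat_diff)
  have pn: "int p = 2 * int n + 1" using p(2) unfolding n_def by presburger
  have key1: "[2 * int k + 1 = - 2 * (int n - int k)] (mod int p)"
    by (simp add: cong_iff_dvd_diff pn algebra_simps)
  have "(4 * int k + 1) * (4 * int k + 3) - 4 * ((int n - 2 * int k) * (int n - 2 * int k - 1))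
      = int p * (8 * int k + 3 - 2 * int n)" unfolding pn by (simp add: algebra_simps)
  hence key2: "[(4 * int k + 1) * (4 * int k + 3)
      = 4 * ((int n - 2 * int k) * (int n - 2 * int k - 1))] (mod int p)"
    by (simp add: cong_iff_dvd_diff)
  have "int (((4 * Suc k) choose (2 * Suc k)) * (Suc k * (2 * k + 1)))
     = int (((4 * k) choose (2 * k)) * (2 * (4 * k + 1) * (4 * k + 3)))"
    by (simp only: central_binomial_step)
  hence "B (Suc k) * (int (Suc k) * int (2 * k + 1))
      = B k * (2 * ((4 * int k + 1) * (4 * int k + 3)))"
    unfolding B_def of_nat_mult by (simp add: algebra_simps)
  also have "[\<dots> = G k * (2 * (4 * ((int n - 2 * int k) * (int n - 2 * int k - 1))))] (mod int p)"
    by (intro cong_mult IH key2 cong_refl)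
  \<comment> \<open>Split 8 as (-2)(-4): the -4 raises the power to \<open>Suc k\<close>, and the -2
    is kept to form -2(n-k), which \<open>key1\<close> turns into 2k+1.\<close>
  also have "G k * (2 * (4 * ((int n - 2 * int k) * (int n - 2 * int k - 1))))
      = - 2 * int (((n - k) choose k) * ((n - 2 * k) * (n - 2 * k - 1))) * (- 4) ^ Suc k"
    unfolding of_nat_mult diffs by (simp add: G_def algebra_simps)
  also have "\<dots> = G (Suc k) * (int (Suc k) * (- 2 * (int n - int k)))"
    unfolding binomial_diff_step[OF kn, symmetric] G_def of_nat_mult
    using kn by (simp add: algebra_simps)
  also have "[\<dots> = G (Suc k) * (int (Suc k) * int (2 * k + 1))] (mod int p)"
    using key1 by (intro cong_mult cong_refl) (simp add: cong_sym add.commute)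
  finally have "[B (Suc k) * (int (Suc k) * int (2 * k + 1))
      = G (Suc k) * (int (Suc k) * int (2 * k + 1))] (mod int p)" .
  moreover have "2 * k + 2 < p" using kn pn by simp
  hence "coprime (int (Suc k) * int (2 * k + 1)) (int p)"
    by (intro coprime_mult_left_iff[THEN iffD2] conjI coprime_int_primeI[OF p(1)]) auto
  ultimately have "[B (Suc k) = G (Suc k)] (mod int p)" using cong_mult_rcancel by blast
  thus ?case by (simp only: B_def G_def n_def)
qed

text \<open>For p = 4m+1 the symbol is 1, for p = 4m+3 it is -1; either way the sum is 4m+2.\<close>

lemma half_p_plus_Legendre:
  assumes "prime p" "odd p"
  shows "nat ((int p + Legendre (- 1) (int p)) div 2) = Suc (2 * (p div 4))"
proof -
  have p2: "p > 2" using prime_ge_2_nat[OF assms(1)] assms(2) by (cases "p = 2") auto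
  have c: "[Legendre (- 1) (int p) = (- 1) ^ ((p - 1) div 2)] (mod int p)"
    using euler_criterion[OF assms(1) p2] .
  have L: "Legendre (- 1) (int p) \<in> {-1, 0, 1}" by (simp add: Legendre_def)
  have "p = 4 * (p div 4) + 1 \<or> p = 4 * (p div 4) + 3" using assms(2) by presburger
  then consider "p = 4 * (p div 4) + 1" | "p = 4 * (p div 4) + 3" by blast
  thus ?thesis
  proof cases
    case 1
    hence "even ((p - 1) div 2)" by presburger
    with c have "int p dvd Legendre (- 1) (int p) - 1" by (simp add: cong_iff_dvd_diff)
    \<comment> \<open>Euler's criterion fixes the symbol only modulo \<open>p\<close>. The values
      -1, 0, 1 differ by at most 2, and \<open>p > 2\<close> separates them.\<close>
    hence "Legendre (- 1) (int p) = 1" using L p2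
      by (auto dest!: dvd_imp_le_int[rotated])
    hence "int p + Legendre (- 1) (int p) = 2 * int (Suc (2 * (p div 4)))"
      using arg_cong[OF 1, of int] by simp
    thus ?thesis by simp
  next
    case 2
    hence "odd ((p - 1) div 2)" by presburger
    with c have "int p dvd Legendre (- 1) (int p) + 1" by (simp add: cong_iff_dvd_diff)
    hence "Legendre (- 1) (int p) = - 1" using L p2
      by (auto dest!: dvd_imp_le_int[rotated])
    hence "int p + Legendre (- 1) (int p) = 2 * int (Suc (2 * (p div 4)))"
      using arg_cong[OF 2, of int] by simp
    thus ?thesis by simp
  qed
qed

theorem theorem2p1:
  fixes p :: nat and P Q :: rat
  assumes "prime p" and "odd p"
    and "p_integral p P" and "p_integral p Q"
    and "\<not> rat_cong p (P * Q) 0"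
  shows "rat_cong p
           (\<Sum>k = 0..p div 4. of_nat ((4 * k) choose (2 * k)) * (P\<^sup>2 / (64 * Q)) ^ k)
           ((- Q) powi (- int (p div 4))
              * lucas_U P Q (nat ((int p + Legendre (- 1) (int p)) div 2)))
       \<and> rat_cong p
           (\<Sum>k = 0..p div 4. of_nat ((4 * k) choose (2 * k)) * (Q / (4 * P\<^sup>2)) ^ k)
           (of_int (rat_Legendre P p) * lucas_U P Q ((p + 1) div 2))"
proof
  note pp = assms(1)
  note intros = p_integral_intros[OF pp]
  define m where "m = p div 4"
  define n where "n = (p - 1) div 2"
  \<comment> \<open>The condition on \<open>P * Q\<close> is split so that each factor has a
    \<open>p\<close>-integral inverse.\<close>
  have P0: "\<not> rat_cong p P 0"
    using assms(5) rat_cong_mult[OF pp _ rat_cong_refl[OF pp assms(4)], of P 0] by auto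
  have Q0: "\<not> rat_cong p Q 0"
    using assms(5) rat_cong_mult[OF pp rat_cong_refl[OF pp assms(3)], of Q 0] by auto
  have two0: "\<not> rat_cong p 2 0"
  proof
    assume "rat_cong p 2 0"
    hence "[2 = 0] (mod int p)" using rat_cong_of_int_iff[OF pp, of 2 0] by simp
    hence "int p dvd int 2" by (simp add: cong_iff_dvd_diff)
    hence "p dvd 2" by (simp only: of_nat_dvd_iff)
    hence "p = 2" using pp two_is_prime_nat primes_dvd_imp_eq by blast
    thus False using assms(2) by simp
  qed
  have Pnz: "P \<noteq> 0" and Qnz: "Q \<noteq> 0"
    using P0 Q0 rat_cong_refl[OF pp p_integral_0[OF pp]] by auto
  have iP: "p_integral p (inverse P)" using p_integral_inverse[OF pp assms(3) P0] .
  have iQ: "p_integral p (inverse Q)" using p_integral_inverse[OF pp assms(4) Q0] .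
  have i2: "p_integral p (inverse 2)"
    using p_integral_inverse[OF pp p_integral_numeral[OF pp] two0] .
  \<comment> \<open>Termwise transfer of an integer binomial congruence, with \<open>d\<close> equal
    to -64 or -4 and \<open>r\<close> a power of the series argument.\<close>
  have cong_binomial: "rat_cong p (of_nat a * r) (of_nat b * c ^ k * r)"
    if "[int a = int b * d ^ k] (mod int p)" "c = of_int d" "p_integral p r" for a b d k c r
    using rat_cong_mult[OF pp rat_cong_of_int_iff[OF pp, THEN iffD2, OF that(1)]
        rat_cong_refl[OF pp that(3)]] that(2) by simp

  show "rat_cong p
           (\<Sum>k = 0..p div 4. of_nat ((4 * k) choose (2 * k)) * (P\<^sup>2 / (64 * Q)) ^ k)
           ((- Q) powi (- int (p div 4))
              * lucas_U P Q (nat ((int p + Legendre (- 1) (int p)) div 2)))"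
  proof -
    \<comment> \<open>Since 64 = 2^6, integrality reduces to that of the inverses of 2 and
      \<open>Q\<close>.\<close>
    have "P\<^sup>2 / (64 * Q) = P\<^sup>2 * (inverse 2 ^ 6 * inverse Q)"
      by (simp add: divide_simps)
    hence int: "p_integral p (P\<^sup>2 / (64 * Q))"
      using assms(3) iQ i2 by (auto intro!: intros)
    have "(- Q) powi (- int m) * lucas_U P Q (Suc (2 * m))
        = (\<Sum>k = 0..m. of_nat ((m + k) choose (2 * k)) * (- 64) ^ k * (P\<^sup>2 / (64 * Q)) ^ k)"
      unfolding lucas_U_odd_sum sum_distrib_left
    proof (rule sum.cong[OF refl])
      fix k assume "k \<in> {0..m}"
      hence k: "k \<le> m" by simp
      \<comment> \<open>The exponents add up to -m + (m - k) = -k, so the prefactor of the theorem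
        leaves exactly \<open>inverse ((- Q) ^ k)\<close>.\<close>
      have "(- Q) powi (- int m) * (- Q) ^ (m - k) = inverse ((- Q) ^ k)"
        using Qnz k by (simp add: power_int_minus power_diff field_simps)
      moreover have "(- Q) powi (- int m)
          * (of_nat ((m + k) choose (2 * k)) * P ^ (2 * k) * (- Q) ^ (m - k))
        = of_nat ((m + k) choose (2 * k))
          * ((P\<^sup>2) ^ k * ((- Q) powi (- int m) * (- Q) ^ (m - k)))"
        unfolding power_mult by (simp only: mult_ac)
      ultimately have "(- Q) powi (- int m)
          * (of_nat ((m + k) choose (2 * k)) * P ^ (2 * k) * (- Q) ^ (m - k))
        = of_nat ((m + k) choose (2 * k)) * ((P\<^sup>2) ^ k * inverse ((- Q) ^ k))"
        by (simp only:)
      also have "(P\<^sup>2) ^ k * inverse ((- Q) ^ k) = (- 64) ^ k * (P\<^sup>2 / (64 * Q)) ^ k"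
        unfolding power_inverse[symmetric] power_mult_distrib[symmetric] using Qnz
        by (simp add: field_simps)
      finally show "(- Q) powi (- int m)
          * (of_nat ((m + k) choose (2 * k)) * P ^ (2 * k) * (- Q) ^ (m - k))
        = of_nat ((m + k) choose (2 * k)) * (- 64) ^ k * (P\<^sup>2 / (64 * Q)) ^ k"
        by (simp only: mult.assoc)
    qed
    moreover have "rat_cong p
        (\<Sum>k = 0..m. of_nat ((4 * k) choose (2 * k)) * (P\<^sup>2 / (64 * Q)) ^ k)
        (\<Sum>k = 0..m. of_nat ((m + k) choose (2 * k)) * (- 64) ^ k * (P\<^sup>2 / (64 * Q)) ^ k)"
      unfolding m_def
      by (intro rat_cong_sum[OF pp] cong_binomial[where d = "- 64"]
          binomial_add_double_cong[OF assms(1,2)]) (auto intro: intros int)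
    ultimately show ?thesis
      unfolding half_p_plus_Legendre[OF assms(1,2)] m_def[symmetric] by simp
  qed

  show "rat_cong p
           (\<Sum>k = 0..p div 4. of_nat ((4 * k) choose (2 * k)) * (Q / (4 * P\<^sup>2)) ^ k)
           (of_int (rat_Legendre P p) * lucas_U P Q ((p + 1) div 2))"
  proof -
    let ?S = "\<Sum>k = 0..m. of_nat ((n - k) choose k) * (- 4) ^ k * (Q / (4 * P\<^sup>2)) ^ k"
    let ?L = "of_int (rat_Legendre P p) :: rat"
    obtain j where j: "p = 2 * j + 1" using assms(2) by (elim oddE)
    have nm: "n div 2 = m" "(p + 1) div 2 = Suc n"
      unfolding n_def m_def j by simp_all
    have "Q / (4 * P\<^sup>2) = Q * (inverse 2 ^ 2 * inverse P ^ 2)"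
      by (simp add: divide_simps)
    hence int: "p_integral p (Q / (4 * P\<^sup>2))"
      using assms(4) iP i2 by (auto intro!: intros)
    have U: "lucas_U P Q ((p + 1) div 2) = P ^ n * ?S"
      unfolding nm(2) lucas_U_Suc_sum_half nm(1) sum_distrib_left
    proof (rule sum.cong[OF refl])
      fix k assume "k \<in> {0..m}"
      hence k: "2 * k \<le> n" using nm by auto
      have "P ^ (n - 2 * k) * (- Q) ^ k = P ^ n * (inverse (P\<^sup>2) ^ k * (- Q) ^ k)"
        using Pnz k by (simp add: power_diff field_simps flip: power_mult)
      \<comment> \<open>The base is -Q / P^2 = -4 * (Q / (4 P^2)), the source of the power of -4
        matched by \<open>binomial_diff_cong\<close>.\<close>
      also have "inverse (P\<^sup>2) ^ k * (- Q) ^ k = (- 4) ^ k * (Q / (4 * P\<^sup>2)) ^ k"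
        unfolding power_mult_distrib[symmetric] using Pnz by (simp add: field_simps)
      finally show "of_nat ((n - k) choose k) * P ^ (n - 2 * k) * (- Q) ^ k
          = P ^ n * (of_nat ((n - k) choose k) * (- 4) ^ k * (Q / (4 * P\<^sup>2)) ^ k)"
        by (metis mult.assoc mult.left_commute)
    qed
    have iS: "p_integral p ?S"
      using p_integral_of_int[OF pp, of "- 4"]
      by (auto intro!: intros int p_integral_of_nat[OF pp])
    \<comment> \<open>Euler's criterion replaces \<open>P ^ n\<close> by the symbol, which then
      cancels against the prefactor because its square is 1.\<close>
    have "rat_cong p (?L * (P ^ n * ?S)) (?L * (?L * ?S))"
      unfolding n_def
      by (intro rat_cong_mult[OF pp] rat_cong_refl[OF pp] p_integral_of_int[OF pp]
          rat_euler_criterion[OF pp assms(2,3)] iS[unfolded n_def])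
    also have "?L * (?L * ?S) = of_int (rat_Legendre P p * rat_Legendre P p) * ?S" by simp
    also have "\<dots> = ?S" by (simp add: rat_Legendre_square[OF pp assms(3) P0] del: of_int_mult)
    finally have "rat_cong p ?S (?L * lucas_U P Q ((p + 1) div 2))"
      unfolding U by (rule rat_cong_sym[OF pp])
    moreover have "rat_cong p
        (\<Sum>k = 0..m. of_nat ((4 * k) choose (2 * k)) * (Q / (4 * P\<^sup>2)) ^ k) ?S"
      unfolding m_def n_def
      by (intro rat_cong_sum[OF pp] cong_binomial[where d = "- 4"]
          binomial_diff_cong[OF assms(1,2)]) (auto intro: intros int)
    ultimately show ?thesis unfolding m_def using rat_cong_trans[OF pp] by blast
  qed
qed

end
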